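(* For every prime power $q$ and all integers $n,t\ge 2$, \[ \chi_q(t;n) \le \left\lceil \frac{n}{t-1} \right\rceil . \]
   Context: For a prime power $q$ and integer $n\ge1$, $\mathrm{PG}(n-1,q)$ is the projective space whose points are the $1$-dimensional subspaces of $\mathbb{F}_q^n$; a $(t-1)$-dimensional projective subspace is the set of points contained in a $t$-dimensional linear subspace of $\mathbb{F}_q^n$. For an integer $t\ge 2$, $\chi_q(t;n)$ denotes the minimum number of colors needed to color the points of $\mathrm{PG}(n-1,q)$ so that no $(t-1)$-dimensional projective subspace is monochromatic (all its points receiving the same color). In particular, if $n\le t-1$ there is no such subspace and $\chi_q(t;n)=1$. *)

theory Defs
  imports
    "Jordan_Normal_Form.Missing_VectorSpace"
    "HOL-Number_Theory.Prime_Powers"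
begin

text \<open>
  The finite field is a parameter \<open>F\<close>; finite fields of the same order are isomorphic,
  so \<open>chi F t n\<close> below depends on \<open>F\<close> only through its order \<open>q\<close>
  and stands for $\chi_q(t;n)$.
\<close>

definition coord_space :: "('a, 'm) ring_scheme \<Rightarrow> nat \<Rightarrow> ('a, nat \<Rightarrow> 'a) module"
  where "coord_space F n = ring.func_space F {..<n}"

definition linear_subspaces ::
    "('a, 'm) ring_scheme \<Rightarrow> nat \<Rightarrow> nat \<Rightarrow> (nat \<Rightarrow> 'a) set set"
  where "linear_subspaces F n d =
    {W. VectorSpace.subspace F W (coord_space F n) \<and>
        vectorspace.dim F ((coord_space F n)\<lparr>carrier := W\<rparr>) = d}"

definition pg_points :: "('a, 'm) ring_scheme \<Rightarrow> nat \<Rightarrow> (nat \<Rightarrow> 'a) set set"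
  where "pg_points F n = linear_subspaces F n 1"

text \<open>The parameter \<open>t\<close> is the linear dimension: these are the projective subspaces of
  projective dimension \<open>t - 1\<close>.\<close>

definition pg_subspaces ::
    "('a, 'm) ring_scheme \<Rightarrow> nat \<Rightarrow> nat \<Rightarrow> (nat \<Rightarrow> 'a) set set set"
  where "pg_subspaces F n t =
    {{P \<in> pg_points F n. P \<subseteq> W} | W. W \<in> linear_subspaces F n t}"

definition monochromatic :: "('p \<Rightarrow> 'c) \<Rightarrow> 'p set \<Rightarrow> bool"
  where "monochromatic c S \<longleftrightarrow> (\<exists>a. \<forall>P\<in>S. c P = a)"

definition admissible_coloring ::
    "('a, 'm) ring_scheme \<Rightarrow> nat \<Rightarrow> nat \<Rightarrow> nat \<Rightarrow> ((nat \<Rightarrow> 'a) set \<Rightarrow> nat) \<Rightarrow> bool"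
  where "admissible_coloring F t n k c \<longleftrightarrow>
    c \<in> pg_points F n \<rightarrow> {..<k} \<and>
    (\<forall>S\<in>pg_subspaces F n t. \<not> monochromatic c S)"

definition chi :: "('a, 'm) ring_scheme \<Rightarrow> nat \<Rightarrow> nat \<Rightarrow> nat"
  where "chi F t n = (LEAST k. \<exists>c. admissible_coloring F t n k c)"

end

theory Submission
  imports Defs "HOL-Algebra.Multiplicative_Group"
begin

text \<open>
  Split the \<open>n\<close> coordinates into \<open>\<lceil>n / (t - 1)\<rceil>\<close> consecutive blocks of at most \<open>t - 1\<close>
  coordinates and color a point by the block containing its leading coordinate. If all points of a
  linear subspace \<open>W\<close> get the same color, then no nonzero vector of \<open>W\<close> vanishes on the
  corresponding block, so restriction to that block is injective on \<open>W\<close> and \<open>dim W \<le> t - 1\<close>.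
\<close>

text \<open>Coordinates with respect to a finite basis identify vectors with functions from the
  basis to the scalars.\<close>

lemma (in vectorspace) card_carrier_eq_order_power_dim:
  assumes "finite (carrier V)"
  shows "card (carrier V) = order K ^ dim"
proof -
  \<comment> \<open>Being finite, the carrier is itself a finite generating set, which yields
    \<open>fin_dim\<close>.\<close>
  have "span (carrier V) = carrier V"
    using in_own_span[of "carrier V"] span_is_subset2[of "carrier V"] by auto
  then have "fin_dim"
    using assms unfolding fin_dim_def by blast
  then obtain A where A: "finite A" "basis A"
    using finite_basis_exists by blast
  have AV: "A \<subseteq> carrier V"
    using A(2) unfolding basis_def by blast
  have ex1: "\<exists>!a. a \<in> A \<rightarrow>\<^sub>E carrier K \<and> lincomb a A = v" if "v \<in> carrier V" for v
    using basis_criterion[OF A(1) AV] A(2) that by blast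
  have "bij_betw (\<lambda>a. lincomb a A) (A \<rightarrow>\<^sub>E carrier K) (carrier V)"
    unfolding bij_betw_def
  proof (rule conjI)
    have cl: "lincomb a A \<in> carrier V" if "a \<in> A \<rightarrow>\<^sub>E carrier K" for a
      using lincomb_closed[OF AV] that by (auto simp: PiE_def)
    show "inj_on (\<lambda>a. lincomb a A) (A \<rightarrow>\<^sub>E carrier K)"
      by (rule inj_onI) (metis cl ex1)
    show "(\<lambda>a. lincomb a A) ` (A \<rightarrow>\<^sub>E carrier K) = carrier V"
    proof
      show "carrier V \<subseteq> (\<lambda>a. lincomb a A) ` (A \<rightarrow>\<^sub>E carrier K)"
        using ex1 by blast
    qed (use cl in blast)
  qed
  then have "card (carrier V) = card (A \<rightarrow>\<^sub>E carrier K)"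
    by (simp add: bij_betw_same_card)
  also have "\<dots> = order K ^ card A"
    using A(1) by (simp add: card_PiE order_def)
  also have "card A = dim"
    using dim_basis[OF A] by simp
  finally show ?thesis .
qed

context field
begin

lemma vectorspace_coord_space: "vectorspace R (coord_space R n)"
  unfolding coord_space_def vectorspace_def
  using func_space_is_module field_axioms by blast

lemma coord_space_simps:
  "carrier (coord_space R n) = {..<n} \<rightarrow>\<^sub>E carrier R"
  "\<zero>\<^bsub>coord_space R n\<^esub> = (\<lambda>i\<in>{..<n}. \<zero>)"
  "v \<oplus>\<^bsub>coord_space R n\<^esub> w = (\<lambda>i\<in>{..<n}. v i \<oplus> w i)"
  "c \<odot>\<^bsub>coord_space R n\<^esub> v = (\<lambda>i\<in>{..<n}. c \<otimes> v i)"
  by (simp_all add: coord_space_def func_space_def)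

lemma order_gt_1:
  assumes "finite (carrier R)"
  shows "1 < order R"
proof -
  have "card {\<zero>, \<one>} \<le> card (carrier R)"
    by (intro card_mono assms) auto
  then show ?thesis
    by (simp add: order_def)
qed

lemma coord_space_eq_zeroI:
  assumes "v \<in> carrier (coord_space R n)" and "\<And>i. i < n \<Longrightarrow> v i = \<zero>"
  shows "v = \<zero>\<^bsub>coord_space R n\<^esub>"
  using assms by (auto simp: coord_space_simps PiE_def extensional_def fun_eq_iff)

text \<open>By \<open>zero\<close>, restriction to \<open>B\<close> has trivial kernel on
  \<open>W\<close>, hence is injective. The dimensions are then compared by counting: with
  \<open>q = order R\<close>, \<open>q ^ dim W = card W\<close> is at most
  \<open>q ^ card B\<close>.\<close>

lemma dim_subspace_le_card_coords:
  assumes "finite (carrier R)"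
    and W: "VectorSpace.subspace R W (coord_space R n)"
    and B: "B \<subseteq> {..<n}"
    and zero: "\<And>v. v \<in> W \<Longrightarrow> (\<And>i. i \<in> B \<Longrightarrow> v i = \<zero>) \<Longrightarrow> v = \<zero>\<^bsub>coord_space R n\<^esub>"
  shows "vectorspace.dim R ((coord_space R n)\<lparr>carrier := W\<rparr>) \<le> card B"
proof -
  let ?V = "coord_space R n"
  interpret V: vectorspace R ?V
    by (rule vectorspace_coord_space)
  interpret W: vectorspace R "?V\<lparr>carrier := W\<rparr>"
    using V.subspace_is_vs[OF W] .
  have sub: "LinearCombinations.submodule R W ?V"
    using W unfolding VectorSpace.subspace_def by blast
  then have WV: "W \<subseteq> carrier ?V"
    unfolding LinearCombinations.submodule_def by blast
  have finV: "finite (carrier ?V)"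
    by (simp add: coord_space_simps finite_PiE assms(1))
  have finB: "finite B"
    using B finite_subset by blast
  have inj: "inj_on (\<lambda>v. restrict v B) W"
  proof (rule inj_onI)
    fix v w assume vw: "v \<in> W" "w \<in> W" "restrict v B = restrict w B"
    \<comment> \<open>The difference is written through addition and scalar multiplication, the
      operations under which a submodule is closed by definition.\<close>
    define d where "d = v \<oplus>\<^bsub>?V\<^esub> ((\<ominus> \<one>) \<odot>\<^bsub>?V\<^esub> w)"
    have vc: "v i \<in> carrier R" "w i \<in> carrier R" if "i < n" for i
      using vw(1,2) WV that by (auto simp: coord_space_simps)
    have d: "d i = v i \<ominus> w i" if "i < n" for i
      using that vc[OF that] by (simp add: d_def coord_space_simps minus_eq l_minus)
    have "d \<in> W"
      using sub vw(1,2) unfolding d_def LinearCombinations.submodule_def by simp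
    moreover have "d i = \<zero>" if "i \<in> B" for i
    proof -
      have "v i = w i"
        using vw(3) that by (metis restrict_apply')
      with that B d vc show ?thesis
        by (auto simp: r_neg minus_eq)
    qed
    ultimately have "d = \<zero>\<^bsub>?V\<^esub>"
      using zero by blast
    then have "v i = w i" if "i < n" for i
      using that d[OF that] vc[OF that] r_right_minus_eq[of "v i" "w i"]
      by (auto simp: coord_space_simps simp del: r_right_minus_eq)
    \<comment> \<open>Both functions are \<open>undefined\<close> from \<open>n\<close> on, so
      agreement below \<open>n\<close> gives equality.\<close>
    moreover have "v \<in> extensional {..<n}" "w \<in> extensional {..<n}"
      using vw(1,2) WV by (auto simp: coord_space_simps PiE_def)
    ultimately show "v = w"
      by (intro extensionalityI[of v "{..<n}" w]) auto
  qed
  have "order R ^ W.dim = card W"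
    using W.card_carrier_eq_order_power_dim finite_subset[OF WV finV] by simp
  also have "\<dots> \<le> card (B \<rightarrow>\<^sub>E carrier R)"
  proof (rule card_inj_on_le[OF inj])
    show "(\<lambda>v. restrict v B) ` W \<subseteq> B \<rightarrow>\<^sub>E carrier R"
      using WV B by (force simp: coord_space_simps)
    show "finite (B \<rightarrow>\<^sub>E carrier R)"
      using finB assms(1) by (simp add: finite_PiE)
  qed
  also have "\<dots> = order R ^ card B"
    using finB by (simp add: card_PiE order_def)
  finally show ?thesis
    using order_gt_1[OF assms(1)] power_le_imp_le_exp by blast
qed

text \<open>The point is the span of \<open>v\<close>: its elements are scalar multiples of
  \<open>v\<close> and so inherit the zeros of \<open>v\<close>. That last property later carries a
  nonzero coordinate of the point back to \<open>v\<close>.\<close>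

lemma point_through_vector:
  assumes W: "VectorSpace.subspace R W (coord_space R n)"
    and v: "v \<in> W" "v \<noteq> \<zero>\<^bsub>coord_space R n\<^esub>"
  obtains P where "P \<in> pg_points R n" "P \<subseteq> W" "v \<in> P"
    "\<And>w i. w \<in> P \<Longrightarrow> i < n \<Longrightarrow> v i = \<zero> \<Longrightarrow> w i = \<zero>"
proof
  let ?V = "coord_space R n"
  interpret V: vectorspace R ?V
    by (rule vectorspace_coord_space)
  have sub: "LinearCombinations.submodule R W ?V"
    using W unfolding VectorSpace.subspace_def by blast
  then have vV: "v \<in> carrier ?V"
    using v(1) unfolding LinearCombinations.submodule_def by blast
  have subP: "VectorSpace.subspace R (V.span {v}) ?V"
    using V.span_is_subspace vV by simp
  then interpret P: vectorspace R "?V\<lparr>carrier := V.span {v}\<rparr>"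
    by (rule V.subspace_is_vs)
  show vP: "v \<in> V.span {v}"
    using V.in_own_span vV by blast
  \<comment> \<open>The dimension of a point is taken in the structure with restricted carrier, so
    the span there has to be identified with the ambient one.\<close>
  have "P.span {v} = V.span {v}"
    using V.span_li_not_depend(1)[of "{v}" "V.span {v}"] V.span_is_submodule vV vP by simp
  then have "P.dim = 1"
    by (intro P.dim1I[of v]) (use vP v(2) in auto)
  with subP show "V.span {v} \<in> pg_points R n"
    by (simp add: pg_points_def linear_subspaces_def)
  show "V.span {v} \<subseteq> W"
    using V.span_is_subset[OF _ sub] v(1) by simp
  fix w i assume w: "w \<in> V.span {v}" and i: "i < n" "v i = \<zero>"
  obtain a where a: "a \<in> {v} \<rightarrow> carrier R" "V.lincomb a {v} = w"
    using V.finite_in_span[OF _ _ w] vV by auto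
  then have "w = a v \<odot>\<^bsub>?V\<^esub> v"
    using vV by (auto simp: V.lincomb_def)
  with a(1) i show "w i = \<zero>"
    by (simp add: coord_space_simps)
qed

text \<open>Nonzero vectors of a point are proportional, so for a point this is the position of the
  first nonzero entry of any of them. Quantifying over the whole point avoids choosing a
  representative.\<close>

definition leading_coord :: "(nat \<Rightarrow> 'a) set \<Rightarrow> nat"
  where "leading_coord P = (LEAST i. \<exists>v\<in>P. v i \<noteq> \<zero>)"

text \<open>Otherwise the point would be the zero space, of dimension 0. The bound
  \<open>i < n\<close> matters because entries from \<open>n\<close> on are
  \<open>undefined\<close>, possibly nonzero, and could otherwise determine
  \<open>leading_coord\<close>.\<close>

lemma pg_point_nonzero_coord:
  assumes "P \<in> pg_points R n"
  shows "\<exists>i<n. \<exists>v\<in>P. v i \<noteq> \<zero>"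
proof (rule ccontr)
  assume asm: "\<not> ?thesis"
  let ?V = "coord_space R n"
  interpret V: vectorspace R ?V
    by (rule vectorspace_coord_space)
  have P: "VectorSpace.subspace R P ?V"
      "vectorspace.dim R (?V\<lparr>carrier := P\<rparr>) = 1"
    using assms by (auto simp: pg_points_def linear_subspaces_def)
  interpret P: vectorspace R "?V\<lparr>carrier := P\<rparr>"
    using V.subspace_is_vs[OF P(1)] .
  have sub: "P \<subseteq> carrier ?V"
    using P(1) by (simp add: VectorSpace.subspace_def LinearCombinations.submodule_def)
  have "v = \<zero>\<^bsub>?V\<^esub>" if "v \<in> P" for v
    using coord_space_eq_zeroI sub asm that by blast
  moreover have "\<zero>\<^bsub>?V\<^esub> \<in> P"
    using P(1) by (simp add: VectorSpace.subspace_def LinearCombinations.submodule_def)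
  ultimately have "P = {\<zero>\<^bsub>?V\<^esub>}"
    by blast
  then have "carrier (?V\<lparr>carrier := P\<rparr>) = {\<zero>\<^bsub>?V\<^esub>}"
    by simp
  then have "P.span {\<zero>\<^bsub>?V\<lparr>carrier := P\<rparr>\<^esub>} = carrier (?V\<lparr>carrier := P\<rparr>)"
    using P.in_own_span[of "{\<zero>\<^bsub>?V\<^esub>}"] P.span_is_subset2[of "{\<zero>\<^bsub>?V\<^esub>}"]
    by (simp add: subset_antisym)
  then have "P.dim = 0"
    by (rule P.dim0I)
  with P(2) show False
    by simp
qed

lemma leading_coord_less:
  assumes "P \<in> pg_points R n"
  shows "leading_coord P < n"
proof -
  obtain i where "i < n" "\<exists>v\<in>P. v i \<noteq> \<zero>"
    using pg_point_nonzero_coord[OF assms] by blast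
  then show ?thesis
    unfolding leading_coord_def by (metis (mono_tags, lifting) Least_le le_less_trans)
qed

text \<open>A nonzero vector of \<open>W\<close> vanishing on the block of the common color
  \<open>a\<close> would span a point of \<open>W\<close> with leading coordinate in that block,
  where the vector vanishes. Hence the dimension \<open>t\<close> would be at most the block length
  \<open>s\<close>.\<close>

lemma leading_coord_block_coloring_not_monochromatic:
  assumes fin: "finite (carrier R)" and "0 < s" and "s < t"
    and S: "S \<in> pg_subspaces R n t"
  shows "\<not> monochromatic (\<lambda>P. leading_coord P div s) S"
proof
  let ?V = "coord_space R n"
  assume "monochromatic (\<lambda>P. leading_coord P div s) S"
  then obtain a where a: "\<And>P. P \<in> S \<Longrightarrow> leading_coord P div s = a"
    by (auto simp: monochromatic_def)
  obtain W where W: "VectorSpace.subspace R W ?V" "vectorspace.dim R (?V\<lparr>carrier := W\<rparr>) = t"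
    and S_eq: "S = {P \<in> pg_points R n. P \<subseteq> W}"
    using S by (auto simp: pg_subspaces_def linear_subspaces_def)
  \<comment> \<open>Intersecting with \<open>{..<n}\<close> truncates the last block when
    \<open>s\<close> does not divide \<open>n\<close>.\<close>
  define B where "B = {a * s..<a * s + s} \<inter> {..<n}"
  have "vectorspace.dim R (?V\<lparr>carrier := W\<rparr>) \<le> card B"
  proof (rule dim_subspace_le_card_coords[OF fin W(1)])
    show "B \<subseteq> {..<n}"
      by (simp add: B_def)
    fix v assume v: "v \<in> W" and vB: "\<And>i. i \<in> B \<Longrightarrow> v i = \<zero>"
    show "v = \<zero>\<^bsub>?V\<^esub>"
    proof (rule ccontr)
      assume "v \<noteq> \<zero>\<^bsub>?V\<^esub>"
      then obtain P where P: "P \<in> pg_points R n" "P \<subseteq> W"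
        and Pv: "\<And>w i. w \<in> P \<Longrightarrow> i < n \<Longrightarrow> v i = \<zero> \<Longrightarrow> w i = \<zero>"
        using point_through_vector[OF W(1) v] by metis
      have less: "leading_coord P < n"
        using leading_coord_less[OF P(1)] .
      have "\<exists>w\<in>P. w (leading_coord P) \<noteq> \<zero>"
        unfolding leading_coord_def using pg_point_nonzero_coord[OF P(1)]
        by (intro LeastI_ex[where P = "\<lambda>i. \<exists>w\<in>P. w i \<noteq> \<zero>"]) auto
      then have "v (leading_coord P) \<noteq> \<zero>"
        using Pv less by blast
      moreover have "leading_coord P div s = a"
        using a P S_eq by simp
      then have "leading_coord P \<in> B"
        using less dividend_less_div_times[OF \<open>0 < s\<close>, of "leading_coord P"]
        by (auto simp: B_def add.commute)
      ultimately show False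
        using vB by blast
    qed
  qed
  also have "card B \<le> card {a * s..<a * s + s}"
    unfolding B_def by (intro card_mono) auto
  finally show False
    using W(2) \<open>s < t\<close> by simp
qed

end

theorem theorem1p3:
  fixes F :: "('a, 'm) ring_scheme" and q n t :: nat
  assumes "primepow q"
    and "field F" and "finite (carrier F)" and "order F = q"
    and "n \<ge> 2" and "t \<ge> 2"
  shows "int (chi F t n) \<le> \<lceil>real n / (real t - 1)\<rceil>"
proof -
  interpret field F by fact
  define s where "s = t - 1"
  have s: "0 < s" "s < t" "real t - 1 = real s"
    using \<open>t \<ge> 2\<close> by (auto simp: s_def)
  define k where "k = nat \<lceil>real n / real s\<rceil>"
  \<comment> \<open>Strictness comes from \<open>i < n\<close>, so the block numbers stay within the
    colors \<open>0, ..., k - 1\<close>.\<close>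
  have "i div s < k" if "i < n" for i
  proof -
    have "real (i div s) \<le> real i / real s"
      by (rule of_nat_div_le_of_nat)
    also have "\<dots> < real n / real s"
      using that s(1) by (simp add: divide_strict_right_mono)
    also have "\<dots> \<le> real k"
      unfolding k_def by linarith
    finally show ?thesis
      by simp
  qed
  then have "admissible_coloring F t n k (\<lambda>P. leading_coord P div s)"
    using leading_coord_less leading_coord_block_coloring_not_monochromatic[OF assms(3) s(1,2)]
    by (auto simp: admissible_coloring_def)
  then have "chi F t n \<le> k"
    unfolding chi_def by (intro Least_le) blast
  \<comment> \<open>Since \<open>nat\<close> sends negative integers to 0, nonnegativity is what
    lets \<open>k\<close> be read back as the integer ceiling.\<close>
  moreover have "0 \<le> \<lceil>real n / real s\<rceil>"
    unfolding zero_le_ceiling by (rule less_le_trans[of _ 0]) auto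
  ultimately show ?thesis
    unfolding k_def s(3) by linarith
qed

end
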